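(* Let $T>0$, $I=[0,T]$, and let $\alpha,\beta\in\mathcal{C}(I)$ satisfy $0<m\le\alpha(t),\beta(t)\le M\le 1$ for every $t\in I$, where $m,M$ are constants. Put $\Gamma_{\mathrm{low}}:=\min_{z\in[m,M]}\Gamma(z)$, $\Gamma_{\mathrm{up}}:=\max_{z\in[m,M]}\Gamma(z)$, $C_W:=\frac{(M+1)\Gamma_{\mathrm{up}}}{(m+1)\Gamma_{\mathrm{low}}}$, and $$\Delta_{\min}:=\min_{t\in I}[\beta(t)-\alpha(t)],\qquad \Delta_{\max}:=\max_{t\in I}[\beta(t)-\alpha(t)].$$ These extrema are attained, and $m-M\le\Delta_{\min}\le\beta(t)-\alpha(t)\le\Delta_{\max}\le M-m$ for all $t\in I$. Moreover, for every $x\in\mathcal{C}^1(I)$: (i) For $t\in(0,T]$: Case A. If $\Delta_{\max}\le 0$, then $|\mathscr{V}_{\alpha,\beta}[x](t)|\le C_W\|x\|_{\mathcal{C}^1}$ for all $t\in(0,T]$ with $t\le 1$; $|\mathscr{V}_{\alpha,\beta}[x](t)|\le C_W\,t^{\alpha(t)-\beta(t)}\|x\|_{\mathcal{C}^1}\le C_W T^{M-m}\|x\|_{\mathcal{C}^1}$ for all $t\in(0,T]$ with $t>1$; and consequently $$|\mathscr{V}_{\alpha,\beta}[x](t)|\le C_W\max\{1,T^{M-m}\}\,\|x\|_{\mathcal{C}^1}\quad\text{for all }t\in(0,T].$$ Case B. If $\Delta_{\min}\ge 0$, then for $t\in(0,T]$ $$|\mathscr{V}_{\alpha,\beta}[x](t)|\le\begin{cases}C_W\,t^{-\Delta_{\max}}\|x\|_{\mathcal{C}^1},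 & 0<t\le 1,\\ C_W\|x\|_{\mathcal{C}^1}, & 1<t\le T.\end{cases}$$ Case C. If $\Delta_{\min}<0<\Delta_{\max}$, then for $t\in(0,T]$ $$|\mathscr{V}_{\alpha,\beta}[x](t)|\le\begin{cases}C_W\,t^{-\Delta_{\max}}\|x\|_{\mathcal{C}^1}, & 0<t\le 1,\\ C_W\,t^{-\Delta_{\min}}\|x\|_{\mathcal{C}^1}, & 1<t\le T.\end{cases}$$ (ii) At $t=0$: $|\mathscr{V}_{\alpha,\beta}[x](0)|\le C_W\|x\|_{\mathcal{C}^1}$.
   Context: $\mathcal{C}(I)$ is the space of continuous real-valued functions on $I=[0,T]$ with $\|x\|_\infty=\sup_{t\in I}|x(t)|$; $\mathcal{C}^1(I)$ is the space of continuously differentiable functions on $I$ (one-sided derivatives at the endpoints) with norm $\|x\|_{\mathcal{C}^1}=\|x\|_\infty+\|\dot{x}\|_\infty$. A time-varying memory exponent is a continuous function $\varrho:I\to\mathbb{R}$ with $\varrho(t)\in(0,1]$ for all $t\in I$. Its memory kernel is $K_\varrho(t,\tau)=\frac{(t-\tau)^{\varrho(t)-1}}{\Gamma(\varrho(t))}$ for $0\le\tau<t\le T$, and $K_\varrho(t,\tau)=0$ for $\tau\ge t$, where $\Gamma$ is the Gamma function. For memory exponents $\alpha,\beta$ and $x\in\mathcal{C}^1(I)$, the memory-weighted velocity operator is the function $\mathscr{V}_{\alpha,\beta}[x]:I\to\mathbb{R}$ given by $$\mathscr{V}_{\alpha,\beta}[x](t)=\frac{\int_0^t K_\alpha(t,\tau)\,[x(t)-x(\tau)]\,d\tau}{\int_0^t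 K_\beta(t,\tau)\,(t-\tau)\,d\tau}\quad (t\in(0,T]),\qquad \mathscr{V}_{\alpha,\beta}[x](0)=\dot{x}(0).$$ *)

theory Defs
  imports "HOL-Analysis.Analysis"
begin

text \<open>The time interval is \<open>I = {0..T}\<close>. Functions on \<open>I\<close> are total functions on the reals, of which
  only the values on \<open>I\<close> are used; in particular derivatives are taken within \<open>I\<close>, hence are
  one-sided at the endpoints.\<close>

definition velocity :: "real \<Rightarrow> (real \<Rightarrow> real) \<Rightarrow> real \<Rightarrow> real" where
  "velocity T x t = vector_derivative x (at t within {0..T})"

definition C1_space :: "real \<Rightarrow> (real \<Rightarrow> real) set" where
  "C1_space T = {x. x differentiable_on {0..T} \<and> continuous_on {0..T} (velocity T x)}"

definition sup_norm :: "real \<Rightarrow> (real \<Rightarrow> real) \<Rightarrow> real" where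
  "sup_norm T x = (SUP t\<in>{0..T}. \<bar>x t\<bar>)"

definition C1_norm :: "real \<Rightarrow> (real \<Rightarrow> real) \<Rightarrow> real" where
  "C1_norm T x = sup_norm T x + sup_norm T (velocity T x)"

definition mem_kernel :: "(real \<Rightarrow> real) \<Rightarrow> real \<Rightarrow> real \<Rightarrow> real" where
  "mem_kernel \<rho> t \<tau> = (if \<tau> < t then (t - \<tau>) powr (\<rho> t - 1) / Gamma (\<rho> t) else 0)"

definition mem_velocity ::
    "real \<Rightarrow> (real \<Rightarrow> real) \<Rightarrow> (real \<Rightarrow> real) \<Rightarrow> (real \<Rightarrow> real) \<Rightarrow> real \<Rightarrow> real" where
  "mem_velocity T \<alpha> \<beta> x t =
     (if t = 0 then velocity T x 0
      else integral {0..t} (\<lambda>\<tau>. mem_kernel \<alpha> t \<tau> * (x t - x \<tau>))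
         / integral {0..t} (\<lambda>\<tau>. mem_kernel \<beta> t \<tau> * (t - \<tau>)))"

text \<open>The minima and maxima below are written as infima and suprema; that they are attained is
  part of the theorem.\<close>

definition Gamma_low :: "real \<Rightarrow> real \<Rightarrow> real" where
  "Gamma_low m M = (INF z\<in>{m..M}. Gamma z)"

definition Gamma_up :: "real \<Rightarrow> real \<Rightarrow> real" where
  "Gamma_up m M = (SUP z\<in>{m..M}. Gamma z)"

definition C_W :: "real \<Rightarrow> real \<Rightarrow> real" where
  "C_W m M = ((M + 1) * Gamma_up m M) / ((m + 1) * Gamma_low m M)"

definition Delta_min :: "real \<Rightarrow> (real \<Rightarrow> real) \<Rightarrow> (real \<Rightarrow> real) \<Rightarrow> real" where
  "Delta_min T \<alpha> \<beta> = (INF t\<in>{0..T}. \<beta> t - \<alpha> t)"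

definition Delta_max :: "real \<Rightarrow> (real \<Rightarrow> real) \<Rightarrow> (real \<Rightarrow> real) \<Rightarrow> real" where
  "Delta_max T \<alpha> \<beta> = (SUP t\<in>{0..T}. \<beta> t - \<alpha> t)"

end

theory Submission
  imports Defs
begin

text \<open>Since \<open>\<bar>x t - x \<tau>\<bar> \<le> L (t - \<tau>)\<close> with \<open>L\<close> the supremum of the velocity, both integrals in the memory-weighted
  velocity reduce to \<open>\<integral> (t - \<tau>) powr a d\<tau> = t powr (a + 1) / (a + 1)\<close>, so that the operator is bounded by
  \<open>L \<cdot> (\<beta> + 1) \<Gamma>(\<beta>) / ((\<alpha> + 1) \<Gamma>(\<alpha>)) \<cdot> t powr (\<alpha> - \<beta>)\<close>. The three cases only differ in how \<open>t powr (\<alpha> - \<beta>)\<close>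
  is estimated.\<close>

section \<open>Integral of a reflected power\<close>

lemma has_integral_reflected_powr:
  fixes a t :: real
  assumes a: "a > -1" and t: "t \<ge> 0"
  shows "((\<lambda>\<tau>. (t - \<tau>) powr a) has_integral t powr (a + 1) / (a + 1)) {0..t}"
proof -
  let ?F = "\<lambda>\<tau>. - ((t - \<tau>) powr (a + 1) / (a + 1))"
  have "((\<lambda>\<tau>. (t - \<tau>) powr a) has_integral ?F t - ?F 0) {0..t}"
  \<comment> \<open>For negative \<open>a\<close> the integrand is singular at
    \<open>\<tau> = t\<close>. The interior version asks for the derivative on the open interval
    only, together with continuity of \<open>?F\<close> up to the endpoints, which holds because
    \<open>a + 1 > 0\<close>.\<close>
  proof (rule fundamental_theorem_of_calculus_interior[OF t])
    show "continuous_on {0..t} ?F"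
      using a by (intro continuous_intros continuous_on_powr') auto
  next
    fix \<tau> assume "\<tau> \<in> {0<..<t}"
    then have "((\<lambda>\<tau>. (t - \<tau>) powr (a + 1)) has_real_derivative (a + 1) * - ((t - \<tau>) powr a)) (at \<tau>)"
      by (auto intro!: derivative_eq_intros)
    from DERIV_minus[OF DERIV_cdivide[OF this, of "a + 1"]]
    have "(?F has_real_derivative (t - \<tau>) powr a) (at \<tau>)"
      using a by simp
    then show "(?F has_vector_derivative (t - \<tau>) powr a) (at \<tau>)"
      by (rule has_real_derivative_iff_has_vector_derivative[THEN iffD1])
  qed
  then show ?thesis using a by simp
qed

section \<open>Sup norm, C1 norm and the Lipschitz bound\<close>

lemma abs_le_sup_norm:
  assumes "continuous_on {0..T} x" "t \<in> {0..T}"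
  shows "\<bar>x t\<bar> \<le> sup_norm T x"
proof -
  \<comment> \<open>The reals are only conditionally complete, so \<open>sup_norm\<close> dominates
    the values once they are known to be bounded above; compactness supplies this.\<close>
  have "compact ((\<lambda>t. \<bar>x t\<bar>) ` {0..T})"
    using assms(1) by (intro compact_continuous_image continuous_intros) auto
  then have "bdd_above ((\<lambda>t. \<bar>x t\<bar>) ` {0..T})"
    by (intro bounded_imp_bdd_above compact_imp_bounded)
  then show ?thesis
    unfolding sup_norm_def using assms(2) by (rule cSUP_upper2) simp
qed

lemma sup_norm_nonneg:
  assumes "continuous_on {0..T} x" "T \<ge> 0"
  shows "0 \<le> sup_norm T x"
  using abs_le_sup_norm[OF assms(1), of 0] assms(2) by simp

text \<open>Mean value inequality on the convex set \<open>{0..T}\<close>, with derivatives taken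
  within it so that the endpoints are covered. The derivative at \<open>u\<close> is multiplication
  by the velocity, whose operator norm is at most the supremum of the speed.\<close>

lemma C1_space_lipschitz:
  assumes x: "x \<in> C1_space T" and s: "s \<in> {0..T}" and t: "t \<in> {0..T}"
  shows "\<bar>x t - x s\<bar> \<le> sup_norm T (velocity T x) * \<bar>t - s\<bar>"
proof -
  have "(x has_derivative (\<lambda>h. h *\<^sub>R velocity T x u)) (at u within {0..T})" if "u \<in> {0..T}" for u
  proof -
    have "x differentiable (at u within {0..T})"
      using x that by (simp add: C1_space_def differentiable_on_def)
    then show ?thesis
      by (simp only: vector_derivative_works has_vector_derivative_def velocity_def)
  qed
  moreover have "onorm (\<lambda>h. h *\<^sub>R velocity T x u) \<le> sup_norm T (velocity T x)"
    if u: "u \<in> {0..T}" for u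
  proof (rule onorm_le)
    fix h :: real
    have "\<bar>velocity T x u\<bar> \<le> sup_norm T (velocity T x)"
      using x u by (intro abs_le_sup_norm) (auto simp: C1_space_def)
    then show "norm (h *\<^sub>R velocity T x u) \<le> sup_norm T (velocity T x) * norm h"
      by (simp add: abs_mult mult.commute mult_left_mono)
  qed
  ultimately have "norm (x t - x s) \<le> sup_norm T (velocity T x) * norm (t - s)"
    using s t by (intro differentiable_bound[where S = "{0..T}"]) auto
  then show ?thesis by simp
qed

lemma sup_norm_velocity_le_C1_norm:
  assumes "x \<in> C1_space T" "T \<ge> 0"
  shows "sup_norm T (velocity T x) \<le> C1_norm T x"
proof -
  have "0 \<le> sup_norm T x"
    using assms by (intro sup_norm_nonneg differentiable_imp_continuous_on) (auto simp: C1_space_def)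
  then show ?thesis by (simp add: C1_norm_def)
qed

lemma C1_norm_nonneg:
  assumes "x \<in> C1_space T" "T \<ge> 0"
  shows "0 \<le> C1_norm T x"
proof -
  have "0 \<le> sup_norm T (velocity T x)"
    using assms by (intro sup_norm_nonneg) (auto simp: C1_space_def)
  then show ?thesis
    using sup_norm_velocity_le_C1_norm[OF assms] by simp
qed

section \<open>Kernel integrals and the pointwise estimate\<close>

lemma mem_kernel_mult_diff:
  assumes "\<tau> \<le> t"
  shows "mem_kernel \<rho> t \<tau> * (t - \<tau>) = (t - \<tau>) powr \<rho> t / Gamma (\<rho> t)"
  \<comment> \<open>The factor \<open>t - \<tau>\<close> raises the exponent by one. At
    \<open>\<tau> = t\<close> both sides are 0, because the kernel is 0 there and
    \<open>0 powr a = 0\<close> for every \<open>a\<close>.\<close>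
  using assms by (auto simp: mem_kernel_def powr_diff)

lemma has_integral_mem_kernel_mult_diff:
  assumes "\<rho> t > -1" "t \<ge> 0"
  shows "((\<lambda>\<tau>. mem_kernel \<rho> t \<tau> * (t - \<tau>)) has_integral
    t powr (\<rho> t + 1) / ((\<rho> t + 1) * Gamma (\<rho> t))) {0..t}"
proof -
  have "((\<lambda>\<tau>. (t - \<tau>) powr \<rho> t / Gamma (\<rho> t)) has_integral
      t powr (\<rho> t + 1) / (\<rho> t + 1) / Gamma (\<rho> t)) {0..t}"
    by (intro has_integral_divide has_integral_reflected_powr assms)
  then show ?thesis
    by (auto simp: mem_kernel_mult_diff intro: has_integral_eq_rhs
        elim!: has_integral_eq[rotated])
qed

text \<open>Only the numerator is estimated; the denominator is computed exactly. Inside the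
  integrals the exponents are the constants \<open>\<alpha> t\<close> and \<open>\<beta> t\<close>,
  so positivity is asked at this one time.\<close>

lemma abs_mem_velocity_le:
  assumes x: "x \<in> C1_space T" and t: "t \<in> {0<..T}" and a: "\<alpha> t > 0" and b: "\<beta> t > 0"
  shows "\<bar>mem_velocity T \<alpha> \<beta> x t\<bar> \<le> sup_norm T (velocity T x) *
    (((\<beta> t + 1) * Gamma (\<beta> t)) / ((\<alpha> t + 1) * Gamma (\<alpha> t)) * t powr (\<alpha> t - \<beta> t))"
proof -
  let ?L = "sup_norm T (velocity T x)"
  let ?I = "\<lambda>\<rho>. t powr (\<rho> t + 1) / ((\<rho> t + 1) * Gamma (\<rho> t))"
  let ?f = "\<lambda>\<tau>. mem_kernel \<alpha> t \<tau> * (x t - x \<tau>)"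
  have G: "Gamma (\<alpha> t) > 0" "Gamma (\<beta> t) > 0"
    using a b by (auto intro: Gamma_real_pos)
  have L: "0 \<le> ?L"
    using x t by (intro sup_norm_nonneg) (auto simp: C1_space_def)
  have g: "((\<lambda>\<tau>. ?L * (mem_kernel \<alpha> t \<tau> * (t - \<tau>))) has_integral ?L * ?I \<alpha>) {0..t}"
    using a t by (intro has_integral_mult_right has_integral_mem_kernel_mult_diff) auto
  have bound: "norm (?f \<tau>) \<le> ?L * (mem_kernel \<alpha> t \<tau> * (t - \<tau>))" if \<tau>: "\<tau> \<in> {0..t}" for \<tau>
  proof -
    have "\<bar>x t - x \<tau>\<bar> \<le> ?L * (t - \<tau>)"
      using C1_space_lipschitz[OF x, of \<tau> t] \<tau> t by simp
    moreover have "0 \<le> mem_kernel \<alpha> t \<tau>"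
      using G by (simp add: mem_kernel_def)
    ultimately show ?thesis
      by (simp add: abs_mult mult.left_commute mult_left_mono)
  qed
  have num: "\<bar>integral {0..t} ?f\<bar> \<le> ?L * ?I \<alpha>"
  \<comment> \<open>A non-integrable function has integral 0 by convention, and the right-hand side
    is nonnegative, so the bound holds in either case.\<close>
  proof (cases "?f integrable_on {0..t}")
    case True
    then have "norm (integral {0..t} ?f) \<le>
        integral {0..t} (\<lambda>\<tau>. ?L * (mem_kernel \<alpha> t \<tau> * (t - \<tau>)))"
      using g bound by (intro integral_norm_bound_integral) auto
    then show ?thesis using integral_unique[OF g] by simp
  next
    case False
    then show ?thesis using L G a by (simp add: not_integrable_integral)
  qed
  have "integral {0..t} (\<lambda>\<tau>. mem_kernel \<beta> t \<tau> * (t - \<tau>)) = ?I \<beta>"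
    using b t by (intro integral_unique has_integral_mem_kernel_mult_diff) auto
  then have "\<bar>mem_velocity T \<alpha> \<beta> x t\<bar> = \<bar>integral {0..t} ?f\<bar> / ?I \<beta>"
    using t b G by (simp add: mem_velocity_def abs_mult)
  also have "\<dots> \<le> ?L * ?I \<alpha> / ?I \<beta>"
    using num b G by (intro divide_right_mono) auto
  also have "\<dots> = ?L * (((\<beta> t + 1) * Gamma (\<beta> t)) / ((\<alpha> t + 1) * Gamma (\<alpha> t)) *
      (t powr (\<alpha> t + 1) / t powr (\<beta> t + 1)))"
    using a b G by (simp add: field_simps)
  also have "t powr (\<alpha> t + 1) / t powr (\<beta> t + 1) = t powr (\<alpha> t - \<beta> t)"
    by (simp flip: powr_diff)
  finally show ?thesis .
qed

section \<open>Attained extrema on compact intervals\<close>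

lemma INF_attained:
  fixes f :: "real \<Rightarrow> real"
  assumes "a \<le> b" "continuous_on {a..b} f"
  obtains z where "z \<in> {a..b}" "f z = (INF z\<in>{a..b}. f z)" "\<forall>y\<in>{a..b}. f z \<le> f y"
proof -
  obtain z where z: "z \<in> {a..b}" "\<forall>y\<in>{a..b}. f z \<le> f y"
    using continuous_attains_inf[of "{a..b}" f] assms by auto
  then have "(INF z\<in>{a..b}. f z) = f z"
    by (intro cInf_eq_minimum) auto
  then show ?thesis using that z by simp
qed

lemma SUP_attained:
  fixes f :: "real \<Rightarrow> real"
  assumes "a \<le> b" "continuous_on {a..b} f"
  obtains z where "z \<in> {a..b}" "f z = (SUP z\<in>{a..b}. f z)" "\<forall>y\<in>{a..b}. f y \<le> f z"
proof -
  obtain z where z: "z \<in> {a..b}" "\<forall>y\<in>{a..b}. f y \<le> f z"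
    using continuous_attains_sup[of "{a..b}" f] assms by auto
  then have "(SUP z\<in>{a..b}. f z) = f z"
    by (intro cSup_eq_maximum) auto
  then show ?thesis using that z by simp
qed

section \<open>The bounds in the three cases and at time zero\<close>

theorem corollary2p3:
  fixes T m M :: real and \<alpha> \<beta> :: "real \<Rightarrow> real"
  assumes "T > 0"
    and "continuous_on {0..T} \<alpha>" and "continuous_on {0..T} \<beta>"
    and "0 < m" and "M \<le> 1"
    and "\<And>t. t \<in> {0..T} \<Longrightarrow> m \<le> \<alpha> t \<and> \<alpha> t \<le> M"
    and "\<And>t. t \<in> {0..T} \<Longrightarrow> m \<le> \<beta> t \<and> \<beta> t \<le> M"
  shows
    "(\<exists>z\<in>{m..M}. Gamma z = Gamma_low m M) \<and> (\<exists>z\<in>{m..M}. Gamma z = Gamma_up m M) \<and>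
     (\<forall>z\<in>{m..M}. Gamma_low m M \<le> Gamma z \<and> Gamma z \<le> Gamma_up m M) \<and>
     (\<exists>t\<in>{0..T}. \<beta> t - \<alpha> t = Delta_min T \<alpha> \<beta>) \<and> (\<exists>t\<in>{0..T}. \<beta> t - \<alpha> t = Delta_max T \<alpha> \<beta>) \<and>
     (\<forall>t\<in>{0..T}. m - M \<le> Delta_min T \<alpha> \<beta> \<and> Delta_min T \<alpha> \<beta> \<le> \<beta> t - \<alpha> t \<and>
        \<beta> t - \<alpha> t \<le> Delta_max T \<alpha> \<beta> \<and> Delta_max T \<alpha> \<beta> \<le> M - m) \<and>
     (\<forall>x\<in>C1_space T.
        (Delta_max T \<alpha> \<beta> \<le> 0 \<longrightarrow>
           (\<forall>t\<in>{0<..T}. t \<le> 1 \<longrightarrow> \<bar>mem_velocity T \<alpha> \<beta> x t\<bar> \<le> C_W m M * C1_norm T x) \<and>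
           (\<forall>t\<in>{0<..T}. t > 1 \<longrightarrow>
              \<bar>mem_velocity T \<alpha> \<beta> x t\<bar> \<le> C_W m M * t powr (\<alpha> t - \<beta> t) * C1_norm T x \<and>
              C_W m M * t powr (\<alpha> t - \<beta> t) * C1_norm T x \<le> C_W m M * T powr (M - m) * C1_norm T x) \<and>
           (\<forall>t\<in>{0<..T}. \<bar>mem_velocity T \<alpha> \<beta> x t\<bar> \<le> C_W m M * max 1 (T powr (M - m)) * C1_norm T x)) \<and>
        (Delta_min T \<alpha> \<beta> \<ge> 0 \<longrightarrow>
           (\<forall>t\<in>{0<..T}. \<bar>mem_velocity T \<alpha> \<beta> x t\<bar> \<le>
              (if t \<le> 1 then C_W m M * t powr (- Delta_max T \<alpha> \<beta>) * C1_norm T x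
               else C_W m M * C1_norm T x))) \<and>
        (Delta_min T \<alpha> \<beta> < 0 \<and> 0 < Delta_max T \<alpha> \<beta> \<longrightarrow>
           (\<forall>t\<in>{0<..T}. \<bar>mem_velocity T \<alpha> \<beta> x t\<bar> \<le>
              (if t \<le> 1 then C_W m M * t powr (- Delta_max T \<alpha> \<beta>) * C1_norm T x
               else C_W m M * t powr (- Delta_min T \<alpha> \<beta>) * C1_norm T x))) \<and>
        \<bar>mem_velocity T \<alpha> \<beta> x 0\<bar> \<le> C_W m M * C1_norm T x)"
proof -
  note \<alpha> = assms(6) and \<beta> = assms(7)
  \<comment> \<open>The bounds on \<alpha> at the point 0 show that \<open>{m..M}\<close> is
    nonempty.\<close>
  have mM: "m \<le> M" using \<alpha>[of 0] assms(1) by auto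
  \<comment> \<open>Since \<open>m > 0\<close>, the interval stays away from the poles of
    \<open>Gamma\<close>.\<close>
  have contG: "continuous_on {m..M} (Gamma :: real \<Rightarrow> real)"
    using assms(4) by (intro continuous_on_Gamma) auto
  obtain zl where zl: "zl \<in> {m..M}" "Gamma zl = Gamma_low m M" "\<forall>y\<in>{m..M}. Gamma_low m M \<le> Gamma y"
    using INF_attained[OF mM contG] unfolding Gamma_low_def by metis
  obtain zu where zu: "zu \<in> {m..M}" "Gamma zu = Gamma_up m M" "\<forall>y\<in>{m..M}. Gamma y \<le> Gamma_up m M"
    using SUP_attained[OF mM contG] unfolding Gamma_up_def by metis
  have contD: "continuous_on {0..T} (\<lambda>t. \<beta> t - \<alpha> t)"
    using assms by (intro continuous_intros)
  obtain tl where tl: "tl \<in> {0..T}" "\<beta> tl - \<alpha> tl = Delta_min T \<alpha> \<beta>"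
      "\<forall>t\<in>{0..T}. Delta_min T \<alpha> \<beta> \<le> \<beta> t - \<alpha> t"
    using INF_attained[OF less_imp_le[OF assms(1)] contD] unfolding Delta_min_def by metis
  obtain tu where tu: "tu \<in> {0..T}" "\<beta> tu - \<alpha> tu = Delta_max T \<alpha> \<beta>"
      "\<forall>t\<in>{0..T}. \<beta> t - \<alpha> t \<le> Delta_max T \<alpha> \<beta>"
    using SUP_attained[OF less_imp_le[OF assms(1)] contD] unfolding Delta_max_def by metis
  have Dlow: "m - M \<le> Delta_min T \<alpha> \<beta>" and Dup: "Delta_max T \<alpha> \<beta> \<le> M - m"
    using tl(1,2) tu(1,2) \<alpha>[of tl] \<beta>[of tl] \<alpha>[of tu] \<beta>[of tu] by auto

  have low_pos: "0 < Gamma_low m M"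
    using zl(1,2) assms(4) Gamma_real_pos[of zl] by auto
  have low_up: "Gamma_low m M \<le> Gamma_up m M"
    using zl(3) zu(1,2) by metis
  have den_pos: "0 < (m + 1) * Gamma_low m M"
    using low_pos assms(4) by simp
  \<comment> \<open>Needed twice: it makes \<open>C_W\<close> nonnegative for the monotonicity step
    \<open>mono\<close>, and it absorbs the constant 1 at \<open>t = 0\<close>.\<close>
  have CW1: "1 \<le> C_W m M"
    unfolding C_W_def using den_pos low_up low_pos mM assms(4)
    by (simp add: le_divide_eq_1 mult_mono)

  have main: "\<bar>mem_velocity T \<alpha> \<beta> x t\<bar> \<le> C_W m M * t powr (\<alpha> t - \<beta> t) * C1_norm T x"
    if x: "x \<in> C1_space T" and t: "t \<in> {0<..T}" for x t
  proof -
    have ab: "m \<le> \<alpha> t" "\<alpha> t \<le> M" "m \<le> \<beta> t" "\<beta> t \<le> M"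
      using \<alpha>[of t] \<beta>[of t] t by auto
    have G: "0 < Gamma (\<beta> t)" "Gamma (\<beta> t) \<le> Gamma_up m M" "Gamma_low m M \<le> Gamma (\<alpha> t)"
      using ab zl zu assms(4) by (auto intro: Gamma_real_pos)
    \<comment> \<open>Each factor is bounded separately: those with \<beta> from above by
      \<open>M + 1\<close> and \<open>Gamma_up\<close>, those with \<alpha> from below by
      \<open>m + 1\<close> and \<open>Gamma_low\<close>.\<close>
    have ratio: "((\<beta> t + 1) * Gamma (\<beta> t)) / ((\<alpha> t + 1) * Gamma (\<alpha> t)) \<le> C_W m M"
      unfolding C_W_def using G ab assms(4) low_pos low_up den_pos
      by (intro frac_le mult_mono mult_nonneg_nonneg) auto
    have "\<bar>mem_velocity T \<alpha> \<beta> x t\<bar> \<le> sup_norm T (velocity T x) *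
        (((\<beta> t + 1) * Gamma (\<beta> t)) / ((\<alpha> t + 1) * Gamma (\<alpha> t)) * t powr (\<alpha> t - \<beta> t))"
      using abs_mem_velocity_le[OF x t, of \<alpha> \<beta>] ab assms(4) by simp
    also have "\<dots> \<le> C1_norm T x * (C_W m M * t powr (\<alpha> t - \<beta> t))"
    proof (rule mult_mono)
      show "sup_norm T (velocity T x) \<le> C1_norm T x"
        using sup_norm_velocity_le_C1_norm[OF x] assms(1) by simp
      show "0 \<le> C1_norm T x"
        using C1_norm_nonneg[OF x] assms(1) by simp
      show "((\<beta> t + 1) * Gamma (\<beta> t)) / ((\<alpha> t + 1) * Gamma (\<alpha> t)) * t powr (\<alpha> t - \<beta> t) \<le>
          C_W m M * t powr (\<alpha> t - \<beta> t)"
        by (rule mult_right_mono[OF ratio]) simp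
      show "0 \<le> ((\<beta> t + 1) * Gamma (\<beta> t)) / ((\<alpha> t + 1) * Gamma (\<alpha> t)) * t powr (\<alpha> t - \<beta> t)"
        using G low_pos ab assms(4) by auto
    qed
    finally show ?thesis by (simp add: mult_ac)
  qed

  have mono: "C_W m M * p * C1_norm T x \<le> C_W m M * q * C1_norm T x"
    if "x \<in> C1_space T" "p \<le> q" for x p q
    using C1_norm_nonneg that CW1 assms(1) by (intro mult_right_mono mult_left_mono) auto
  \<comment> \<open>From here on every case is a matter of finding \<open>q\<close> above
    \<open>t powr (\<alpha> t - \<beta> t)\<close>.\<close>
  have bnd: "\<bar>mem_velocity T \<alpha> \<beta> x t\<bar> \<le> C_W m M * q * C1_norm T x"
    if "x \<in> C1_space T" "t \<in> {0<..T}" "t powr (\<alpha> t - \<beta> t) \<le> q" for x t q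
    using main mono that by (meson order_trans)

  \<comment> \<open>For \<open>t \<le> 1\<close> powers decrease in the exponent, so the largest
    value of \<open>\<beta> - \<alpha>\<close> is decisive. The free \<open>d\<close> serves both
    \<open>d = 0\<close> and \<open>d = Delta_max T \<alpha> \<beta>\<close>.\<close>
  have small: "t powr (\<alpha> t - \<beta> t) \<le> t powr (- d)"
    if "t \<in> {0<..T}" "t \<le> 1" "Delta_max T \<alpha> \<beta> \<le> d" for t d
    using that tu(3)[rule_format, of t] by (intro powr_mono') auto
  \<comment> \<open>For \<open>t > 1\<close> powers increase in the exponent, so the smallest value
    of \<open>\<beta> - \<alpha>\<close> is decisive. Here \<open>d\<close> will be 0,
    \<open>Delta_min T \<alpha> \<beta>\<close> or \<open>m - M\<close>.\<close>
  have large: "t powr (\<alpha> t - \<beta> t) \<le> t powr (- d)"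
    if "t \<in> {0<..T}" "1 < t" "d \<le> Delta_min T \<alpha> \<beta>" for t d
    using that tl(3)[rule_format, of t] by (intro powr_mono) auto

  have upper: "t powr (\<alpha> t - \<beta> t) \<le> T powr (M - m)" if "t \<in> {0<..T}" "1 < t" for t
  proof -
    have "t powr (\<alpha> t - \<beta> t) \<le> t powr (M - m)"
      using large[of t "m - M"] that Dlow by simp
    \<comment> \<open>The exponent \<open>M - m\<close> is nonnegative, so the power is monotone in
      the base.\<close>
    also have "\<dots> \<le> T powr (M - m)"
      using that mM by (intro powr_mono2) auto
    finally show ?thesis .
  qed

  have caseA: "(\<forall>t\<in>{0<..T}. t \<le> 1 \<longrightarrow> \<bar>mem_velocity T \<alpha> \<beta> x t\<bar> \<le> C_W m M * C1_norm T x) \<and>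
      (\<forall>t\<in>{0<..T}. t > 1 \<longrightarrow>
        \<bar>mem_velocity T \<alpha> \<beta> x t\<bar> \<le> C_W m M * t powr (\<alpha> t - \<beta> t) * C1_norm T x \<and>
        C_W m M * t powr (\<alpha> t - \<beta> t) * C1_norm T x \<le> C_W m M * T powr (M - m) * C1_norm T x) \<and>
      (\<forall>t\<in>{0<..T}. \<bar>mem_velocity T \<alpha> \<beta> x t\<bar> \<le> C_W m M * max 1 (T powr (M - m)) * C1_norm T x)"
    if x: "x \<in> C1_space T" and D: "Delta_max T \<alpha> \<beta> \<le> 0" for x
  proof -
    have le1: "t powr (\<alpha> t - \<beta> t) \<le> 1" if "t \<in> {0<..T}" "t \<le> 1" for t
      \<comment> \<open>The choice \<open>d = 0\<close> turns the bound into
        \<open>t powr 0\<close>, which is 1 because \<open>t\<close> is nonzero.\<close>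
      using small[OF that D] that by simp
    have "t powr (\<alpha> t - \<beta> t) \<le> max 1 (T powr (M - m))" if "t \<in> {0<..T}" for t
      using le1[OF that] upper[OF that] by linarith
    then show ?thesis
      \<comment> \<open>The instance \<open>q = 1\<close> gives the bound without a power of
        \<open>t\<close>; the general one serves the maximum.\<close>
      using bnd[OF x] bnd[OF x, of _ 1] le1 mono[OF x] upper main[OF x] by simp
  qed

  have caseB: "\<forall>t\<in>{0<..T}. \<bar>mem_velocity T \<alpha> \<beta> x t\<bar> \<le>
      (if t \<le> 1 then C_W m M * t powr (- Delta_max T \<alpha> \<beta>) * C1_norm T x
       else C_W m M * C1_norm T x)"
    if x: "x \<in> C1_space T" and D: "Delta_min T \<alpha> \<beta> \<ge> 0" for x
  proof -
    have "t powr (\<alpha> t - \<beta> t) \<le> 1" if "t \<in> {0<..T}" "1 < t" for t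
      using large[OF that D] that by simp
    then show ?thesis
      using bnd[OF x] bnd[OF x, of _ 1] small by simp
  qed

  have caseC: "\<forall>t\<in>{0<..T}. \<bar>mem_velocity T \<alpha> \<beta> x t\<bar> \<le>
      (if t \<le> 1 then C_W m M * t powr (- Delta_max T \<alpha> \<beta>) * C1_norm T x
       else C_W m M * t powr (- Delta_min T \<alpha> \<beta>) * C1_norm T x)"
    if x: "x \<in> C1_space T" for x
    \<comment> \<open>Here \<open>d\<close> is the extremum itself, \<open>Delta_max\<close> up to
      time 1 and \<open>Delta_min\<close> afterwards.\<close>
    using bnd[OF x] small large by simp

  have zero: "\<bar>mem_velocity T \<alpha> \<beta> x 0\<bar> \<le> C_W m M * C1_norm T x" if x: "x \<in> C1_space T" for x
  proof -
    have "\<bar>velocity T x 0\<bar> \<le> sup_norm T (velocity T x)"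
      using x assms(1) by (intro abs_le_sup_norm) (auto simp: C1_space_def)
    also have "\<dots> \<le> 1 * C1_norm T x"
      using sup_norm_velocity_le_C1_norm[OF x] assms(1) by simp
    also have "\<dots> \<le> C_W m M * C1_norm T x"
      by (rule mult_right_mono[OF CW1 C1_norm_nonneg[OF x]]) (use assms(1) in simp)
    finally show ?thesis by (simp add: mem_velocity_def)
  qed

  show ?thesis
    using zl zu tl tu Dlow Dup caseA caseB caseC zero by (intro conjI ballI impI) blast+
qed

end
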